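(* Let $M\in\mathbb{Z}^{2\times 2}$ be non-singular. Then $\mathcal{G}(M)$ is linearly edge-transitive if and only if, for some $a,b\in\mathbb{Z}$, $M$ is right equivalent to one of the following matrices: $$M_1=\begin{pmatrix} a & b \\ b & a \end{pmatrix},\qquad M_2=\begin{pmatrix} a & -b \\ b & a \end{pmatrix},\qquad M_3=\begin{pmatrix} a & -b \\ a & b \end{pmatrix}.$$
   Context: For a non-singular matrix $M\in\mathbb{Z}^{n\times n}$, $\mathcal{G}(M)$ denotes the undirected Cayley graph $Cay(\mathbb{Z}^n/M\mathbb{Z}^n;\pm\mathcal{B}_n)$, where $\pm\mathcal{B}_n=\{\pm\mathbf{e}_1,\dots,\pm\mathbf{e}_n\}$ and $\mathbf{e}_i$ is the $i$-th standard basis vector: the vertices are the elements of the finite Abelian group $\mathbb{Z}^n/M\mathbb{Z}^n$ (integer column vectors modulo the lattice generated by the columns of $M$), and $\mathbf{v},\mathbf{w}$ are adjacent if and only if $\mathbf{v}-\mathbf{w}\equiv\pm\mathbf{e}_i\pmod M$ for some $i$. $LAut(\mathcal{G}(M),\mathbf{0})$ denotes the group of linear automorphisms of $\mathcal{G}(M)$ fixing $\mathbf{0}$, i.e. the graph automorphisms of $\mathcal{G}(M)$ that are also group automorphisms of $\mathbb{Z}^n/M\mathbb{Z}^n$. $\mathcal{G}(M)$ is linearly edge-transitive if for every $i\in\{1,\dots,n\}$ there exists $f\in LAut(\mathcal{G}(M),\mathbf{0})$ with $f(\mathbf{e}_1)=\pm\mathbf{e}_i$. $M_1,M_2\in\mathbb{Z}^{n\times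 n}$ are right equivalent if there is a unit matrix $P\in\mathbb{Z}^{n\times n}$ (that is, $\det P=\pm1$) such that $M_1=M_2P$. *)

theory Defs
  imports "HOL-Analysis.Determinants" "HOL-Algebra.Coset" "HOL-Algebra.Bij"
begin

section \<open>Undirected graphs\<close>

text \<open>
  A graph is a pair of a vertex set and a set of edges, an edge being the unordered pair \<open>{u, v}\<close>
  of its ends; a singleton \<open>{v}\<close> is a loop.
\<close>

type_synonym 'v ugraph = "'v set \<times> 'v set set"

definition graph_aut :: "'v ugraph \<Rightarrow> ('v \<Rightarrow> 'v) \<Rightarrow> bool" where
  "graph_aut \<Gamma> f \<longleftrightarrow> bij_betw f (fst \<Gamma>) (fst \<Gamma>) \<and>
     (\<forall>u \<in> fst \<Gamma>. \<forall>v \<in> fst \<Gamma>. {u, v} \<in> snd \<Gamma> \<longleftrightarrow> {f u, f v} \<in> snd \<Gamma>)"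

definition Cay :: "('a, 'b) monoid_scheme \<Rightarrow> 'a set \<Rightarrow> 'a ugraph" where
  "Cay G S = (carrier G,
     {{v, w} | v w. v \<in> carrier G \<and> w \<in> carrier G \<and> v \<otimes>\<^bsub>G\<^esub> inv\<^bsub>G\<^esub> w \<in> S})"


section \<open>The group \<open>\<int>\<^sup>n / M\<int>\<^sup>n\<close>\<close>

definition int_vec_group :: "(int ^ 'n) monoid" where
  "int_vec_group = \<lparr>carrier = UNIV, mult = (+), one = 0\<rparr>"

definition col_lattice :: "int ^ 'n ^ 'n \<Rightarrow> (int ^ 'n) set" where
  "col_lattice M = range (\<lambda>x. M *v x)"

definition mod_group :: "int ^ 'n ^ 'n \<Rightarrow> (int ^ 'n) set monoid" where
  "mod_group M = int_vec_group Mod col_lattice M"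

definition residue_class :: "int ^ 'n ^ 'n \<Rightarrow> int ^ 'n \<Rightarrow> (int ^ 'n) set" where
  "residue_class M v = col_lattice M #>\<^bsub>int_vec_group\<^esub> v"


section \<open>The graph \<open>\<G>(M)\<close> and its linear automorphisms\<close>

definition signed_basis :: "(int ^ 'n) set" where
  "signed_basis = (\<Union>i. {axis i 1, - axis i 1})"

definition lattice_graph :: "int ^ 'n ^ 'n \<Rightarrow> (int ^ 'n) set ugraph" where
  "lattice_graph M = Cay (mod_group M) (residue_class M ` signed_basis)"

text \<open>
  The elements of \<open>auto G\<close> are the bijective endomorphisms of \<open>G\<close>, taken to be \<open>undefined\<close>
  outside the carrier. They fix the neutral element, so no separate condition on \<open>0\<close> is needed.
\<close>

definition LAut :: "int ^ 'n ^ 'n \<Rightarrow> ((int ^ 'n) set \<Rightarrow> (int ^ 'n) set) set" where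
  "LAut M = {f \<in> auto (mod_group M). graph_aut (lattice_graph M) f}"

text \<open>
  The class \<open>one\<close> only serves to name the first index; for the numeral types \<open>2\<close>, \<open>3\<close>, and so on
  it is the index of the first entry of \<^const>\<open>vector\<close>.
\<close>

definition linearly_edge_transitive :: "int ^ 'n::{finite, one} ^ 'n::{finite, one} \<Rightarrow> bool" where
  "linearly_edge_transitive M \<longleftrightarrow>
     (\<forall>i. \<exists>f \<in> LAut M. f (residue_class M (axis 1 1))
            \<in> {residue_class M (axis i 1), residue_class M (- axis i 1)})"

definition right_equivalent :: "int ^ 'n ^ 'n \<Rightarrow> int ^ 'n ^ 'n \<Rightarrow> bool" where
  "right_equivalent M1 M2 \<longleftrightarrow> (\<exists>P. (det P = 1 \<or> det P = - 1) \<and> M1 = M2 ** P)"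


section \<open>Basic facts\<close>

lemma comm_group_int_vec_group: "comm_group (int_vec_group :: (int ^ 'n) monoid)"
proof (rule comm_groupI)
  show "\<exists>y \<in> carrier int_vec_group. y \<otimes>\<^bsub>int_vec_group\<^esub> x = \<one>\<^bsub>int_vec_group\<^esub>"
    for x :: "int ^ 'n"
    by (rule bexI[of _ "- x"]) (auto simp: int_vec_group_def)
qed (auto simp: int_vec_group_def)

lemma inv_int_vec_group [simp]: "inv\<^bsub>int_vec_group\<^esub> x = - (x :: int ^ 'n)"
proof -
  interpret comm_group "int_vec_group :: (int ^ 'n) monoid" by (rule comm_group_int_vec_group)
  show ?thesis
    by (rule inv_equality) (auto simp: int_vec_group_def)
qed

lemma subgroup_col_lattice: "subgroup (col_lattice M) int_vec_group"
proof -
  interpret comm_group "int_vec_group :: (int ^ 'n) monoid" by (rule comm_group_int_vec_group)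
  have "- (M *v x) = M *v (- x)" for x
    by (simp add: matrix_vector_mult_def vec_eq_iff sum_negf)
  then show ?thesis
    by (intro subgroupI)
      (auto simp: int_vec_group_def col_lattice_def matrix_vector_right_distrib[symmetric]
         inv_int_vec_group[unfolded int_vec_group_def])
qed

lemma normal_col_lattice: "col_lattice M \<lhd> int_vec_group"
  using comm_group.subgroup_imp_normal[OF comm_group_int_vec_group subgroup_col_lattice] .

lemma comm_group_mod_group: "comm_group (mod_group M)"
  unfolding mod_group_def
  by (rule comm_group.abelian_FactGroup[OF comm_group_int_vec_group subgroup_col_lattice])

lemma residue_class_eq_iff: "residue_class M v = residue_class M w \<longleftrightarrow> v - w \<in> col_lattice M"
proof -
  have mem: "u \<in> residue_class M x \<longleftrightarrow> u - x \<in> col_lattice M" for u x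
    by (force simp: residue_class_def r_coset_def int_vec_group_def)
  have 0: "0 \<in> col_lattice M"
    using subgroup.one_closed[OF subgroup_col_lattice[of M]] by (simp add: int_vec_group_def)
  have add: "a + b \<in> col_lattice M" and neg: "- a \<in> col_lattice M"
    if "a \<in> col_lattice M" "b \<in> col_lattice M" for a b
    using subgroup.m_closed[OF subgroup_col_lattice that]
      subgroup.m_inv_closed[OF subgroup_col_lattice that(1)]
    by (simp_all only: inv_int_vec_group) (simp add: int_vec_group_def)
  show ?thesis
  proof
    assume "residue_class M v = residue_class M w"
    then show "v - w \<in> col_lattice M" using mem[of v v] mem[of v w] 0 by simp
  next
    assume vw: "v - w \<in> col_lattice M"
    have "u - v \<in> col_lattice M \<longleftrightarrow> u - w \<in> col_lattice M" for u
      using add[of "u - v" "v - w"] add[of "u - w" "- (v - w)"] neg[OF vw vw] vw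
      by auto
    then show "residue_class M v = residue_class M w" using mem by blast
  qed
qed

lemma carrier_mod_group: "carrier (mod_group M) = range (residue_class M)"
  by (auto simp: mod_group_def carrier_FactGroup residue_class_def int_vec_group_def)

lemma mult_residue_class:
  "residue_class M v \<otimes>\<^bsub>mod_group M\<^esub> residue_class M w = residue_class M (v + w)"
  using normal.rcos_sum[OF normal_col_lattice[of M], of v w]
  by (simp add: mod_group_def residue_class_def int_vec_group_def)

lemma inv_residue_class: "inv\<^bsub>mod_group M\<^esub> residue_class M v = residue_class M (- v)"
proof -
  interpret comm_group "mod_group M" by (rule comm_group_mod_group)
  have "residue_class M 0 = \<one>\<^bsub>mod_group M\<^esub>"
    by (simp add: mod_group_def residue_class_def r_coset_def int_vec_group_def)
  then show ?thesis
    by (intro inv_equality) (auto simp: mult_residue_class carrier_mod_group)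
qed

lemma residue_class_adjacent_iff:
  "{residue_class M v, residue_class M w} \<in> snd (lattice_graph M) \<longleftrightarrow>
     (\<exists>i. v - w - axis i 1 \<in> col_lattice M \<or> v - w + axis i 1 \<in> col_lattice M)"
    (is "?L \<longleftrightarrow> ?R v w")
proof -
  have diff: "residue_class M x \<otimes>\<^bsub>mod_group M\<^esub> inv\<^bsub>mod_group M\<^esub> residue_class M y
      \<in> residue_class M ` signed_basis \<longleftrightarrow> ?R x y" for x y
    by (auto simp: inv_residue_class mult_residue_class signed_basis_def residue_class_eq_iff
        image_iff)
  have neg: "- a \<in> col_lattice M" if "a \<in> col_lattice M" for a
    using subgroup.m_inv_closed[OF subgroup_col_lattice that] by simp
  have sym: "?R w v \<Longrightarrow> ?R v w"
    by (metis (no_types, opaque_lifting) neg add.commute diff_conv_add_uminus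
        minus_diff_eq minus_minus)
  have "?L \<longleftrightarrow> ?R v w \<or> ?R w v"
    unfolding lattice_graph_def Cay_def snd_conv mem_Collect_eq diff[symmetric] doubleton_eq_iff
    by (auto simp: carrier_mod_group)
  then show ?thesis using sym by blast
qed

end

theory Submission
  imports Defs
begin

text \<open>
  A linear automorphism taking \<open>e\<^sub>1\<close> to \<open>\<plusminus> e\<^sub>2\<close> can be assumed to take \<open>e\<^sub>2\<close> to \<open>\<plusminus> e\<^sub>1\<close>, so it lifts, up to
  sign, to the reflection \<open>(x, y) \<mapsto> (y, x)\<close> or the quarter turn \<open>(x, y) \<mapsto> (- y, x)\<close> of \<open>\<int>\<^sup>2\<close>, and the
  lift preserves the column lattice of \<open>M\<close>; conversely such a symmetry of the lattice descends to
  the quotient. A lattice invariant under the quarter turn is an ideal of \<open>\<int>[i]\<close>, hence principal,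
  and this is \<open>M\<^sub>2\<close>. A lattice invariant under the reflection contains the sum of its intersections
  with the two diagonals with index 1 or 2, and these cases give \<open>M\<^sub>3\<close> and \<open>M\<^sub>1\<close>.
\<close>

section \<open>Column lattices\<close>

lemma mem_residue_class: "u \<in> residue_class M v \<longleftrightarrow> u - v \<in> col_lattice M"
  by (force simp: residue_class_def r_coset_def int_vec_group_def)

lemma
  assumes "subgroup L (int_vec_group :: (int ^ 'n) monoid)"
  shows subgroup_int_vec_zero: "0 \<in> L"
    and subgroup_int_vec_add: "u \<in> L \<Longrightarrow> v \<in> L \<Longrightarrow> u + v \<in> L"
    and subgroup_int_vec_uminus: "u \<in> L \<Longrightarrow> - u \<in> L"
    and subgroup_int_vec_diff: "u \<in> L \<Longrightarrow> v \<in> L \<Longrightarrow> u - v \<in> L"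
proof -
  show "0 \<in> L"
    using subgroup.one_closed[OF assms] by (simp add: int_vec_group_def)
  show add: "u + v \<in> L" if "u \<in> L" "v \<in> L" for u v
    using subgroup.m_closed[OF assms that] by (simp add: int_vec_group_def)
  show neg: "- u \<in> L" if "u \<in> L" for u
    using subgroup.m_inv_closed[OF assms that] by simp
  show "u - v \<in> L" if "u \<in> L" "v \<in> L" for u v
    using add[OF that(1) neg[OF that(2)]] by simp
qed

lemma vector_scale_diff_one: "(i - 1) *s u = i *s u - (u :: 'a::ring_1 ^ 'n)"
  by (simp add: vec_eq_iff left_diff_distrib)

lemma subgroup_int_vec_scale:
  fixes k :: int
  assumes L: "subgroup L (int_vec_group :: (int ^ 'n) monoid)" and u: "u \<in> L"
  shows "k *s u \<in> L"
proof (induction k rule: int_induct[of _ 0])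
  case base
  show ?case using subgroup_int_vec_zero[OF L] by simp
next
  case (step1 i)
  then show ?case
    using subgroup_int_vec_add[OF L _ u] by (simp add: vector_sadd_rdistrib)
next
  case (step2 i)
  then show ?case
    using subgroup_int_vec_diff[OF L _ u] by (simp add: vector_scale_diff_one)
qed

section \<open>Right equivalence as equality of column lattices\<close>

lemma col_lattice_mult_subset: "col_lattice (M ** P) \<subseteq> col_lattice M"
  by (auto simp: col_lattice_def matrix_vector_mul_assoc[symmetric])

text \<open>Every column of \<open>M\<close> lies in the lattice of \<open>N\<close>, so it is
  \<open>N\<close> applied to some integer vector; these vectors are the columns of
  \<open>P\<close>.\<close>

lemma col_lattice_subset_imp_factor:
  fixes M N :: "int ^ 'n ^ 'n"
  assumes "col_lattice M \<subseteq> col_lattice N"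
  obtains P where "M = N ** P"
proof -
  have "\<exists>x. column j M = N *v x" for j
  proof -
    have "M *v axis j 1 \<in> col_lattice N"
      using assms by (auto simp: col_lattice_def)
    moreover have "M *v axis j 1 = column j M"
      by (simp add: vec_eq_iff matrix_vector_mult_def column_def axis_def if_distrib cong: if_cong)
    ultimately show ?thesis by (auto simp: col_lattice_def)
  qed
  then obtain x where x: "\<And>j. column j M = N *v x j" by metis
  have "M = N ** (\<chi> i j. x j $ i)"
    using x by (simp add: vec_eq_iff column_def matrix_matrix_mult_def matrix_vector_mult_def)
  then show thesis ..
qed

lemma unimodular_2_right_inverse:
  fixes P :: "int ^ 2 ^ 2"
  assumes "det P = 1 \<or> det P = - 1"
  obtains Q where "P ** Q = mat 1"
proof
  \<comment> \<open>The adjugate of \<open>P\<close> scaled by \<open>det P\<close>, which is its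
    own inverse.\<close>
  let ?Q = "vector [vector [det P * P $ 2 $ 2, - det P * P $ 1 $ 2],
    vector [- det P * P $ 2 $ 1, det P * P $ 1 $ 1]] :: int ^ 2 ^ 2"
  have sq: "det P * det P = 1" using assms by auto
  have "P ** ?Q = mat (det P * det P)"
    unfolding vec_eq_iff forall_2
    by (simp add: matrix_matrix_mult_def sum_2 mat_def det_2 algebra_simps)
  then show "P ** ?Q = mat 1" by (simp add: sq)
qed

text \<open>Replaces the search for a unimodular \<open>P\<close> by a question about lattices
  alone. Mutual inclusion yields factors both ways, and cancelling the non-zero \<open>det M\<close>
  makes their determinants units.\<close>

lemma right_equivalent_iff_col_lattice:
  fixes M N :: "int ^ 2 ^ 2"
  assumes "det M \<noteq> 0"
  shows "right_equivalent M N \<longleftrightarrow> col_lattice M = col_lattice N"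
proof
  assume "right_equivalent M N"
  then obtain P where P: "det P = 1 \<or> det P = - 1" "M = N ** P"
    by (auto simp: right_equivalent_def)
  obtain Q where "P ** Q = mat 1" using unimodular_2_right_inverse[OF P(1)] .
  then have "N = M ** Q" by (simp add: P(2) matrix_mul_assoc[symmetric])
  then show "col_lattice M = col_lattice N"
    using P(2) by (metis col_lattice_mult_subset subset_antisym)
next
  assume eq: "col_lattice M = col_lattice N"
  obtain P where P: "M = N ** P" using col_lattice_subset_imp_factor[of M N] eq by blast
  obtain Q where Q: "N = M ** Q" using col_lattice_subset_imp_factor[of N M] eq by blast
  have "det M = det M * (det Q * det P)"
    using P Q by (metis det_mul mult.assoc)
  then have "det Q * det P = 1" using assms by simp
  then have "det P = 1 \<or> det P = - 1"
    by (metis mult.commute zmult_eq_1_iff)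
  then show "right_equivalent M N" using P by (auto simp: right_equivalent_def)
qed

section \<open>Linear automorphisms as integer matrices\<close>

text \<open>A symmetry of both the lattice and the signed basis descends to the quotient. The
  hypotheses on the inverse \<open>B\<close> turn the implications for \<open>A\<close> into
  equivalences, as injectivity and the preservation of non-adjacency demand.\<close>

lemma ex_LAut_of_invariant:
  fixes M A B :: "int ^ 'n ^ 'n"
  assumes AB: "A ** B = mat 1" and BA: "B ** A = mat 1"
    and AL: "\<And>v. v \<in> col_lattice M \<Longrightarrow> A *v v \<in> col_lattice M"
    and BL: "\<And>v. v \<in> col_lattice M \<Longrightarrow> B *v v \<in> col_lattice M"
    and AS: "\<And>s. s \<in> signed_basis \<Longrightarrow> A *v s \<in> signed_basis"
    and BS: "\<And>s. s \<in> signed_basis \<Longrightarrow> B *v s \<in> signed_basis"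
  shows "\<exists>f \<in> LAut M. \<forall>v. f (residue_class M v) = residue_class M (A *v v)"
proof -
  let ?R = "residue_class M" and ?C = "carrier (mod_group M)"
  \<comment> \<open>A class is sent to its image as a set, which avoids choosing representatives;
    \<open>restrict\<close> gives the value \<open>undefined\<close> outside the carrier that
    \<open>auto\<close> requires.\<close>
  define f where "f = restrict (\<lambda>X. (*v) A ` X) ?C"
  have ABv: "A *v (B *v v) = v" and BAv: "B *v (A *v v) = v" for v
    by (simp_all add: matrix_vector_mul_assoc AB BA)
  have AL_iff: "A *v v \<in> col_lattice M \<longleftrightarrow> v \<in> col_lattice M" for v
    using AL BL[of "A *v v"] by (auto simp: BAv)
  have R_in: "?R v \<in> ?C" for v by (simp add: carrier_mod_group)
  have f_R: "f (?R v) = ?R (A *v v)" for v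
  proof -
    have "u \<in> (*v) A ` ?R v \<longleftrightarrow> u \<in> ?R (A *v v)" for u
    proof -
      have "u \<in> (*v) A ` ?R v \<longleftrightarrow> B *v u \<in> ?R v"
        by (auto simp: BAv image_iff intro: bexI[of _ "B *v u"] simp: ABv)
      also have "\<dots> \<longleftrightarrow> u \<in> ?R (A *v v)"
        using AL_iff[of "B *v u - v"]
        by (simp add: mem_residue_class matrix_vector_mult_diff_distrib ABv)
      finally show ?thesis .
    qed
    then show ?thesis by (auto simp: f_def R_in)
  qed
  have inj: "inj_on f ?C"
  proof (rule inj_onI)
    fix X Y assume "X \<in> ?C" "Y \<in> ?C" and eq: "f X = f Y"
    then obtain v w where X: "X = ?R v" and Y: "Y = ?R w" by (auto simp: carrier_mod_group)
    have "A *v (v - w) \<in> col_lattice M"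
      using eq by (simp add: X Y f_R residue_class_eq_iff matrix_vector_mult_diff_distrib)
    then show "X = Y" by (simp add: X Y AL_iff residue_class_eq_iff)
  qed
  have surj: "f ` ?C = ?C"
  proof -
    have "?R v \<in> f ` ?C" for v
      using f_R[of "B *v v"] R_in by (metis ABv image_eqI)
    then show ?thesis using f_R R_in by (auto simp: carrier_mod_group)
  qed
  have bij: "bij_betw f ?C ?C" using inj surj by (simp add: bij_betw_def)
  have hom: "f \<in> hom (mod_group M) (mod_group M)"
    by (rule homI)
      (auto simp: carrier_mod_group f_R mult_residue_class matrix_vector_right_distrib)
  have aut: "f \<in> auto (mod_group M)"
    using bij hom by (simp add: auto_def Bij_def f_def)
  have adj: "{?R v, ?R w} \<in> snd (lattice_graph M) \<longleftrightarrow>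
      (\<exists>s \<in> signed_basis. v - w - s \<in> col_lattice M)" for v w
    by (auto simp: residue_class_adjacent_iff signed_basis_def)
  have "{?R v, ?R w} \<in> snd (lattice_graph M) \<longleftrightarrow>
      {?R (A *v v), ?R (A *v w)} \<in> snd (lattice_graph M)" for v w
  proof -
    have eq: "A *v v - A *v w - A *v s \<in> col_lattice M \<longleftrightarrow> v - w - s \<in> col_lattice M" for s
      using AL_iff[of "v - w - s"] by (simp add: matrix_vector_mult_diff_distrib)
    show ?thesis unfolding adj
    proof
      assume "\<exists>s \<in> signed_basis. v - w - s \<in> col_lattice M"
      then show "\<exists>s \<in> signed_basis. A *v v - A *v w - s \<in> col_lattice M"
        using AS eq by blast
    next
      assume "\<exists>s \<in> signed_basis. A *v v - A *v w - s \<in> col_lattice M"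
      then show "\<exists>s \<in> signed_basis. v - w - s \<in> col_lattice M"
        using BS eq ABv by metis
    qed
  qed
  then have "graph_aut (lattice_graph M) f"
    using bij by (auto simp: graph_aut_def lattice_graph_def Cay_def carrier_mod_group f_R)
  then show ?thesis using aut f_R by (auto simp: LAut_def)
qed

text \<open>Representatives of the image classes are kept explicit, so that computations with
  \<open>f\<close> take place among integer vectors.\<close>

lemma
  assumes "f \<in> LAut M"
  shows LAut_add: "f (residue_class M v) = residue_class M p \<Longrightarrow>
      f (residue_class M w) = residue_class M q \<Longrightarrow>
      f (residue_class M (v + w)) = residue_class M (p + q)"
    and LAut_zero: "f (residue_class M 0) = residue_class M 0"
    and LAut_uminus: "f (residue_class M v) = residue_class M p \<Longrightarrow>
      f (residue_class M (- v)) = residue_class M (- p)"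
    and LAut_inj: "f (residue_class M v) = f (residue_class M w) \<Longrightarrow>
      residue_class M v = residue_class M w"
    and LAut_closed: "\<exists>p. f (residue_class M v) = residue_class M p"
    and LAut_adjacent: "{residue_class M v, residue_class M w} \<in> snd (lattice_graph M) \<Longrightarrow>
      {f (residue_class M v), f (residue_class M w)} \<in> snd (lattice_graph M)"
proof -
  let ?R = "residue_class M" and ?C = "carrier (mod_group M)"
  have hom: "f \<in> hom (mod_group M) (mod_group M)" and bij: "bij_betw f ?C ?C"
    and gr: "graph_aut (lattice_graph M) f"
    using assms by (auto simp: LAut_def auto_def Bij_def)
  have R_in: "?R v \<in> ?C" for v by (simp add: carrier_mod_group)
  show add: "f (?R (v + w)) = ?R (p + q)" if "f (?R v) = ?R p" "f (?R w) = ?R q" for v w p q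
    using hom_mult[OF hom R_in[of v] R_in[of w]] that by (simp add: mult_residue_class)
  show closed: "\<exists>p. f (?R v) = ?R p" for v
    using hom_in_carrier[OF hom R_in[of v]] by (auto simp: carrier_mod_group)
  show zero: "f (?R 0) = ?R 0"
  proof -
    obtain p where p: "f (?R 0) = ?R p" using closed by blast
    have "?R (p + p) = ?R p" using add[OF p p] p by simp
    then show ?thesis using p by (simp add: residue_class_eq_iff)
  qed
  show "f (?R (- v)) = ?R (- p)" if p: "f (?R v) = ?R p" for v p
  proof -
    obtain q where q: "f (?R (- v)) = ?R q" using closed by blast
    have "?R (p + q) = ?R 0" using add[OF p q] zero by simp
    then have "q - (- p) \<in> col_lattice M" by (simp add: residue_class_eq_iff add.commute)
    then show ?thesis using q by (simp add: residue_class_eq_iff)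
  qed
  show "?R v = ?R w" if "f (?R v) = f (?R w)" for v w
    using inj_onD[OF bij_betw_imp_inj_on[OF bij] that R_in R_in] .
  show "{f (?R v), f (?R w)} \<in> snd (lattice_graph M)"
    if "{?R v, ?R w} \<in> snd (lattice_graph M)" for v w
    using gr that R_in by (simp add: graph_aut_def lattice_graph_def Cay_def)
qed

lemma LAut_scale:
  assumes f: "f \<in> LAut M" and p: "f (residue_class M v) = residue_class M p"
  shows "f (residue_class M (k *s v)) = residue_class M (k *s p)"
proof (induction k rule: int_induct[of _ 0])
  case base
  show ?case using LAut_zero[OF f] by simp
next
  case (step1 i)
  show ?case using LAut_add[OF f step1(2) p] by (simp add: vector_sadd_rdistrib)
next
  case (step2 i)
  show ?case
    using LAut_add[OF f step2(2) LAut_uminus[OF f p]]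
    by (simp add: vector_scale_diff_one)
qed

section \<open>Lattices invariant under a quarter turn or a reflection\<close>

lemma vector_2_eta: "vector [v $ 1, v $ 2] = (v :: 'a::zero ^ 2)"
  by (simp add: vec_eq_iff forall_2)

lemma mem_col_lattice_2:
  fixes v :: "int ^ 2" and a b c d :: int
  shows "v \<in> col_lattice (vector [vector [a, b], vector [c, d]]) \<longleftrightarrow>
    (\<exists>m n. v $ 1 = a * m + b * n \<and> v $ 2 = c * m + d * n)"
    (is "_ \<longleftrightarrow> ?R")
proof
  assume ?R
  then obtain m n where "v $ 1 = a * m + b * n \<and> v $ 2 = c * m + d * n" by blast
  then have "v = vector [vector [a, b], vector [c, d]] *v (vector [m, n] :: int ^ 2)"
    by (simp add: vec_eq_iff forall_2 matrix_vector_mult_def sum_2)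
  then show "v \<in> col_lattice (vector [vector [a, b], vector [c, d]])"
    by (auto simp: col_lattice_def)
next
  assume "v \<in> col_lattice (vector [vector [a, b], vector [c, d]])"
  then obtain x :: "int ^ 2" where "v = vector [vector [a, b], vector [c, d]] *v x"
    by (auto simp: col_lattice_def)
  then have "v $ 1 = a * x $ 1 + b * x $ 2 \<and> v $ 2 = c * x $ 1 + d * x $ 2"
    by (simp add: matrix_vector_mult_def sum_2)
  then show ?R by blast
qed

text \<open>The least positive element divides every other one, since the remainder modulo it is
  again in \<open>I\<close> and smaller. The zero subgroup has generator 0.\<close>

lemma int_diff_closed_imp_principal:
  fixes I :: "int set"
  assumes 0: "0 \<in> I" and diff: "\<And>x y. x \<in> I \<Longrightarrow> y \<in> I \<Longrightarrow> x - y \<in> I"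
  obtains a where "\<And>t. t \<in> I \<longleftrightarrow> a dvd t"
proof -
  have neg: "- x \<in> I" if "x \<in> I" for x using diff[OF 0 that] by simp
  have add: "x + y \<in> I" if "x \<in> I" "y \<in> I" for x y
    using diff[OF that(1) neg[OF that(2)]] by simp
  have mult: "k * x \<in> I" if "x \<in> I" for k x
    by (induction k rule: int_induct[of _ 0])
      (use 0 add diff that in \<open>auto simp: distrib_right left_diff_distrib\<close>)
  show thesis
  proof (cases "I = {0}")
    case True
    then have "t \<in> I \<longleftrightarrow> 0 dvd t" for t by simp
    then show thesis by (rule that)
  next
    case False
    then obtain x where "x \<in> I" "x \<noteq> 0" using 0 by blast
    then have "\<bar>x\<bar> \<in> I" "\<bar>x\<bar> > 0" using neg by (auto simp: abs_if)
    then have "\<exists>k. int k \<in> I \<and> k > 0" by (intro exI[of _ "nat \<bar>x\<bar>"]) simp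
    then obtain a where a: "int a \<in> I" "a > 0"
      and min: "\<And>k. k < a \<Longrightarrow> \<not> (int k \<in> I \<and> k > 0)"
      using exists_least_iff[of "\<lambda>k. int k \<in> I \<and> k > 0"] by blast
    have "t \<in> I \<longleftrightarrow> int a dvd t" for t
    proof
      assume "t \<in> I"
      then have "t mod int a \<in> I"
        using diff[OF \<open>t \<in> I\<close> mult[OF a(1), of "t div int a"]] by (simp add: minus_div_mult_eq_mod)
      moreover have "nat (t mod int a) < a" using a(2) by (simp add: nat_less_iff)
      ultimately have "\<not> t mod int a > 0" using min[of "nat (t mod int a)"] by auto
      moreover have "t mod int a \<ge> 0" using a(2) by simp
      ultimately have "t mod int a = 0" by linarith
      then show "int a dvd t" by (rule mod_0_imp_dvd)
    next
      assume "int a dvd t"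
      then show "t \<in> I" using mult[OF a(1)] by (metis dvdE mult.commute)
    qed
    then show thesis by (rule that)
  qed
qed

text \<open>The sum and the difference of a vector of \<open>L\<close> and its mirror image lie on
  the two diagonals, so twice the vector decomposes along them inside \<open>L\<close>. Parity
  decides the rest: either every vector decomposes, or one that does not yields, after a correction,
  a generator that spans \<open>L\<close> together with its mirror image.\<close>

lemma swap_invariant_lattice:
  fixes L :: "(int ^ 2) set"
  assumes L: "subgroup L int_vec_group"
    and swap: "\<And>v. v \<in> L \<Longrightarrow> vector [v $ 2, v $ 1] \<in> L"
  shows "\<exists>a b. L = col_lattice (vector [vector [a, b], vector [b, a]]) \<or>
    L = col_lattice (vector [vector [a, - b], vector [a, b]])"
proof -
  let ?v = "\<lambda>x y. vector [x, y] :: int ^ 2"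
  have v_eq: "?v x y + ?v x' y' = ?v (x + x') (y + y')" "?v x y - ?v x' y' = ?v (x - x') (y - y')"
    "k *s ?v x y = ?v (k * x) (k * y)" for k x y x' y'
    by (simp_all add: vec_eq_iff forall_2)
  have zero: "?v 0 0 \<in> L"
    using subgroup_int_vec_scale[OF L, of _ 0] subgroup_int_vec_zero[OF L] v_eq(3)[of 0 0 0]
    by (metis vector_2_eta zero_index)
  have add: "?v (x + x') (y + y') \<in> L" if "?v x y \<in> L" "?v x' y' \<in> L" for x y x' y'
    using subgroup_int_vec_add[OF L that] by (simp add: v_eq)
  have diff: "?v (x - x') (y - y') \<in> L" if "?v x y \<in> L" "?v x' y' \<in> L" for x y x' y'
    using subgroup_int_vec_diff[OF L that] by (simp add: v_eq)
  have scale: "?v (k * x) (k * y) \<in> L" if "?v x y \<in> L" for k x y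
    using subgroup_int_vec_scale[OF L that, of k] by (simp add: v_eq)
  have sw: "?v y x \<in> L" if "?v x y \<in> L" for x y
    using swap[OF that] by simp
  \<comment> \<open>\<open>a\<close> generates the intersection of \<open>L\<close> with the
    diagonal, and \<open>b\<close> below the one with the antidiagonal; \<open>split\<close>
    describes the sum of both intersections.\<close>
  obtain a where a: "\<And>t. ?v t t \<in> L \<longleftrightarrow> a dvd t"
    using int_diff_closed_imp_principal[of "{t. ?v t t \<in> L}"] zero diff by auto
  obtain b where b: "\<And>t. ?v (- t) t \<in> L \<longleftrightarrow> b dvd t"
  proof (rule int_diff_closed_imp_principal[of "{t. ?v (- t) t \<in> L}"])
    show "x - y \<in> {t. ?v (- t) t \<in> L}" if "x \<in> {t. ?v (- t) t \<in> L}" "y \<in> {t. ?v (- t) t \<in> L}"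
      for x y
      using diff[of "- x" x "- y" y] that by simp
  qed (use zero in auto)
  define split where "split x y \<longleftrightarrow> (\<exists>m n. x = a * m - b * n \<and> y = a * m + b * n)" for x y
  have cases: "split x y \<or> (\<exists>p q. x + y = (2 * p + 1) * a \<and> y - x = (2 * q + 1) * b)"
    if xy: "?v x y \<in> L" for x y
  proof -
    have "a dvd x + y" using add[OF xy sw[OF xy]] a[of "x + y"] by (simp add: add.commute)
    then obtain p where p: "x + y = a * p" ..
    have "b dvd y - x" using diff[OF xy sw[OF xy]] b[of "y - x"] by simp
    then obtain q where q: "y - x = b * q" ..
    \<comment> \<open>Twice the vector is \<open>p\<close> times \<open>(a, a)\<close> plus
      \<open>q\<close> times \<open>(- b, b)\<close>. If one coefficient is even, half of that
      component can be subtracted within \<open>L\<close>, and the rest lies on the other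
      diagonal.\<close>
    consider m where "p = 2 * m" | n where "q = 2 * n" | "odd p" "odd q" by blast
    then show ?thesis
    proof cases
      case 1
      have "?v (m * a) (m * a) \<in> L" using a by simp
      moreover have "x - m * a = - (y - m * a)" using p 1 by (simp add: algebra_simps)
      ultimately have "b dvd y - m * a" using diff[OF xy] b by metis
      then obtain n where "y - m * a = b * n" ..
      then have "x = a * m - b * n" "y = a * m + b * n" using p 1 by (simp_all add: algebra_simps)
      then show ?thesis unfolding split_def by blast
    next
      case 2
      have "?v (- (n * b)) (n * b) \<in> L" using b by simp
      moreover have "x - - (n * b) = y - n * b" using q 2 by (simp add: algebra_simps)
      ultimately have "a dvd y - n * b" using diff[OF xy] a by metis
      then obtain m where "y - n * b = a * m" ..
      then have "x = a * m - b * n" "y = a * m + b * n" using q 2 by (simp_all add: algebra_simps)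
      then show ?thesis unfolding split_def by blast
    next
      case 3
      then show ?thesis using p q by (metis oddE mult.commute)
    qed
  qed
  have split_L: "?v x y \<in> L" if "split x y" for x y
  proof -
    obtain m n where "x = a * m - b * n" "y = a * m + b * n" using \<open>split x y\<close> split_def by auto
    then show ?thesis using add[of "a * m" "a * m" "- (b * n)" "b * n"] a b by simp
  qed
  show ?thesis
  proof (cases "\<forall>x y. ?v x y \<in> L \<longrightarrow> split x y")
    case True
    have "v \<in> L \<longleftrightarrow> split (v $ 1) (v $ 2)" for v
      using True split_L vector_2_eta[of v] by metis
    then have "L = col_lattice (vector [vector [a, - b], vector [a, b]])"
      by (auto simp: mem_col_lattice_2 split_def)
    then show ?thesis by blast
  next
    case False
    then obtain x y p q where xy: "?v x y \<in> L"
      and pq: "x + y = (2 * p + 1) * a" "y - x = (2 * q + 1) * b"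
      using cases by blast
    \<comment> \<open>Subtracting \<open>p\<close> times \<open>(a, a)\<close> and \<open>q\<close>
      times \<open>(- b, b)\<close> leaves a vector with coordinate sum \<open>a\<close> and
      difference \<open>b\<close>. Hence \<open>(a, a)\<close> and \<open>(- b, b)\<close> are the
      sum and the difference of \<open>(c, d)\<close> and \<open>(d, c)\<close>.\<close>
    define c d where "c = x - (a * p - b * q)" and "d = y - (a * p + b * q)"
    have "?v (a * p - b * q) (a * p + b * q) \<in> L"
      by (rule split_L) (auto simp: split_def)
    from diff[OF xy this] have cd: "?v c d \<in> L" by (simp add: c_def d_def)
    have ab: "a = c + d" "b = d - c"
      using pq by (simp_all add: c_def d_def algebra_simps)
    have "v \<in> L \<longleftrightarrow> v \<in> col_lattice (vector [vector [c, d], vector [d, c]])" for v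
    proof
      assume "v \<in> L"
      then have "?v (v $ 1) (v $ 2) \<in> L" by (simp add: vector_2_eta)
      from cases[OF this]
      show "v \<in> col_lattice (vector [vector [c, d], vector [d, c]])"
      proof
        assume "split (v $ 1) (v $ 2)"
        then obtain m n where "v $ 1 = c * (m + n) + d * (m - n)" "v $ 2 = d * (m + n) + c * (m - n)"
          unfolding split_def ab by (auto simp: algebra_simps)
        then show ?thesis unfolding mem_col_lattice_2 by blast
      next
        assume "\<exists>p q. v $ 1 + v $ 2 = (2 * p + 1) * a \<and> v $ 2 - v $ 1 = (2 * q + 1) * b"
        then obtain p q where pq: "v $ 1 + v $ 2 = (2 * p + 1) * a" "v $ 2 - v $ 1 = (2 * q + 1) * b"
          by blast
        \<comment> \<open>Solving for \<open>v\<close> doubles its entries; as both coefficients are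
          odd, \<open>c\<close> and \<open>d\<close> get even factors and the halves are
          integral.\<close>
        have "v $ 1 = c * (p + q + 1) + d * (p - q)" "v $ 2 = d * (p + q + 1) + c * (p - q)"
          using pq unfolding ab by (simp_all add: algebra_simps)
        then show ?thesis unfolding mem_col_lattice_2 by blast
      qed
    next
      assume "v \<in> col_lattice (vector [vector [c, d], vector [d, c]])"
      then obtain m n where mn: "v $ 1 = c * m + d * n" "v $ 2 = d * m + c * n"
        by (auto simp: mem_col_lattice_2)
      have "?v (m * c + n * d) (m * d + n * c) \<in> L"
        using add scale cd sw by blast
      then show "v \<in> L" using mn vector_2_eta[of v] by (simp add: mult.commute)
    qed
    then show ?thesis by blast
  qed
qed

section \<open>Division with remainder in Z[i] and rotation-invariant lattices\<close>

lemma ex_int_round: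
  fixes x n :: int
  assumes "n > 0"
  obtains c where "2 * \<bar>x - c * n\<bar> \<le> n"
proof
  \<comment> \<open>The floor of x/n + 1/2, written with numerator and denominator doubled.\<close>
  define c where "c = (2 * x + n) div (2 * n)"
  have "2 * x + n - c * (2 * n) = (2 * x + n) mod (2 * n)"
    by (simp add: c_def minus_div_mult_eq_mod)
  then have "0 \<le> 2 * x + n - c * (2 * n)" "2 * x + n - c * (2 * n) < 2 * n"
    using assms by simp_all
  then show "2 * \<bar>x - c * n\<bar> \<le> n" by (simp add: abs_if)
qed

text \<open>A non-zero vector \<open>w\<close> of least norm divides all others in Z[i]: rounding a
  quotient to a Gaussian integer leaves a remainder of at most half the norm of \<open>w\<close>,
  which must vanish.\<close>

lemma rotation_invariant_lattice:
  fixes L :: "(int ^ 2) set"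
  assumes L: "subgroup L int_vec_group"
    and rot: "\<And>v. v \<in> L \<Longrightarrow> vector [- v $ 2, v $ 1] \<in> L"
  shows "\<exists>a b. L = col_lattice (vector [vector [a, - b], vector [b, a]])"
proof -
  define N :: "int ^ 2 \<Rightarrow> nat" where "N v = nat ((v $ 1)\<^sup>2 + (v $ 2)\<^sup>2)" for v
  have N_int: "int (N v) = (v $ 1)\<^sup>2 + (v $ 2)\<^sup>2" for v by (simp add: N_def)
  have N_pos: "N v > 0" if "v \<noteq> 0" for v
    using that unfolding N_def vec_eq_iff forall_2
    using sum_power2_gt_zero_iff[of "v $ 1" "v $ 2"] by simp
  \<comment> \<open>With \<open>(x, y)\<close> read as x + yi, this is closure under multiplication
    by c + di.\<close>
  have comb: "c *s w + d *s vector [- w $ 2, w $ 1] \<in> L" if "w \<in> L" for c d w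
    by (intro subgroup_int_vec_add[OF L] subgroup_int_vec_scale[OF L] rot that)
  show ?thesis
  proof (cases "L = {0}")
    case True
    then have "L = col_lattice (vector [vector [0, - 0], vector [0, 0]])"
      by (auto simp: mem_col_lattice_2 vec_eq_iff forall_2)
    then show ?thesis by blast
  next
    case False
    then have "\<exists>w. w \<in> L \<and> w \<noteq> 0" using subgroup_int_vec_zero[OF L] by blast
    then obtain w where w: "w \<in> L" "w \<noteq> 0" and min: "\<And>v. v \<in> L \<Longrightarrow> v \<noteq> 0 \<Longrightarrow> N w \<le> N v"
      using exists_least_iff[of "\<lambda>k. \<exists>w. w \<in> L \<and> w \<noteq> 0 \<and> N w = k"] by (metis linorder_not_le)
    define a b where "a = w $ 1" and "b = w $ 2"
    define n where "n = a\<^sup>2 + b\<^sup>2"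
    have n: "n = int (N w)" by (simp add: n_def N_int a_def b_def)
    then have n_pos: "n > 0" using N_pos[OF w(2)] by simp
    have "v \<in> L \<longleftrightarrow> v \<in> col_lattice (vector [vector [a, - b], vector [b, a]])" for v
    proof
      assume v: "v \<in> L"
      let ?x = "v $ 1" and ?y = "v $ 2"
      \<comment> \<open>The quotient v/w is the conjugate of \<open>w\<close> times
        \<open>v\<close>, divided by \<open>n\<close>; \<open>c\<close> and \<open>d\<close> round
        its real and imaginary parts.\<close>
      obtain c where c: "2 * \<bar>(a * ?x + b * ?y) - c * n\<bar> \<le> n" using ex_int_round[OF n_pos] .
      obtain d where d: "2 * \<bar>(a * ?y - b * ?x) - d * n\<bar> \<le> n" using ex_int_round[OF n_pos] .
      let ?r = "v - (c *s w + d *s vector [- w $ 2, w $ 1])"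
      have r: "?r $ 1 = ?x - (c * a - d * b)" "?r $ 2 = ?y - (c * b + d * a)"
        by (simp_all add: a_def b_def)
      let ?X = "(a * ?x + b * ?y) - c * n" and ?Y = "(a * ?y - b * ?x) - d * n"
      \<comment> \<open>The norm is multiplicative, and \<open>?X\<close> and \<open>?Y\<close> are
        the real and imaginary parts of the conjugate of \<open>w\<close> times
        \<open>?r\<close>.\<close>
      have "n * int (N ?r) = ?X\<^sup>2 + ?Y\<^sup>2"
        unfolding N_int r n_def by (simp add: power2_eq_square algebra_simps)
      also have "2 * (?X\<^sup>2 + ?Y\<^sup>2) \<le> n * n"
      proof -
        have "(2 * \<bar>?X\<bar>)\<^sup>2 \<le> n\<^sup>2" "(2 * \<bar>?Y\<bar>)\<^sup>2 \<le> n\<^sup>2"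
          using c d by (intro power_mono; simp)+
        then show ?thesis by (simp add: power_mult_distrib power2_eq_square)
      qed
      finally have "2 * (n * int (N ?r)) \<le> n * n" by simp
      then have "2 * int (N ?r) \<le> n" using n_pos by simp
      then have "N ?r < N w" using n n_pos by linarith
      moreover have "?r \<in> L" using subgroup_int_vec_diff[OF L v comb[OF w(1)]] .
      ultimately have "?r = 0" using min[of ?r] by linarith
      then have "?x = a * c + - b * d \<and> ?y = b * c + a * d"
        using r by (simp add: algebra_simps)
      then show "v \<in> col_lattice (vector [vector [a, - b], vector [b, a]])"
        unfolding mem_col_lattice_2 by blast
    next
      assume "v \<in> col_lattice (vector [vector [a, - b], vector [b, a]])"
      then obtain c d where "v $ 1 = a * c + - b * d" "v $ 2 = b * c + a * d"
        by (auto simp: mem_col_lattice_2)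
      then have "v = c *s w + d *s vector [- w $ 2, w $ 1]"
        by (simp add: vec_eq_iff forall_2 a_def b_def)
      then show "v \<in> L" using comb[OF w(1)] by simp
    qed
    then show ?thesis by blast
  qed
qed

section \<open>Linear edge-transitivity in dimension two\<close>

lemma signed_basis_2:
  "(signed_basis :: (int ^ 2) set) =
    {vector [1, 0], vector [- 1, 0], vector [0, 1], vector [0, - 1]}"
proof -
  have "axis 1 1 = (vector [1, 0] :: int ^ 2)" "axis 2 1 = (vector [0, 1] :: int ^ 2)"
    "- vector [1, 0] = (vector [- 1, 0] :: int ^ 2)"
    "- vector [0, 1] = (vector [0, - 1] :: int ^ 2)"
    by (simp_all add: vec_eq_iff forall_2 axis_def)
  then show ?thesis by (auto simp: signed_basis_def UNIV_2)
qed

text \<open>Removes the graph from the problem. The images of the two basis vectors allow four sign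
  patterns, which collapse to two because a lattice is closed under negation.\<close>

lemma linearly_edge_transitive_2_iff:
  fixes M :: "int ^ 2 ^ 2"
  shows "linearly_edge_transitive M \<longleftrightarrow>
    (\<forall>v \<in> col_lattice M. vector [v $ 2, v $ 1] \<in> col_lattice M) \<or>
    (\<forall>v \<in> col_lattice M. vector [- v $ 2, v $ 1] \<in> col_lattice M)"
    (is "_ \<longleftrightarrow> ?swap \<or> ?rot")
proof
  let ?R = "residue_class M" and ?e1 = "axis 1 1 :: int ^ 2" and ?e2 = "axis 2 1 :: int ^ 2"
  assume "linearly_edge_transitive M"
  then obtain f where f: "f \<in> LAut M" and "f (?R ?e1) \<in> {?R ?e2, ?R (- ?e2)}"
    unfolding linearly_edge_transitive_def by blast
  then obtain p where p: "p \<in> {?e2, - ?e2}" and fp: "f (?R ?e1) = ?R p" by blast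
  obtain q' where q': "f (?R ?e2) = ?R q'" using LAut_closed[OF f] by blast
  \<comment> \<open>As \<open>f\<close> fixes the class of 0, the image of \<open>?e2\<close> is
    again a neighbour of it, hence the class of a signed basis vector.\<close>
  have "{?R ?e2, ?R 0} \<in> snd (lattice_graph M)"
    unfolding residue_class_adjacent_iff using subgroup_int_vec_zero[OF subgroup_col_lattice[of M]]
    by (intro exI[of _ 2]) simp
  then have "{?R q', ?R 0} \<in> snd (lattice_graph M)"
    using LAut_adjacent[OF f] q' LAut_zero[OF f] by metis
  then obtain i where "q' - axis i 1 \<in> col_lattice M \<or> q' - (- axis i 1) \<in> col_lattice M"
    unfolding residue_class_adjacent_iff by auto
  then have "f (?R ?e2) \<in> {?R (axis i 1), ?R (- axis i 1)}"
    unfolding q' by (auto simp: residue_class_eq_iff)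
  then have q'_cases: "f (?R ?e2) \<in> {?R ?e1, ?R (- ?e1), ?R ?e2, ?R (- ?e2)}"
    using exhaust_2[of i] by auto
  have "\<exists>q \<in> {?e1, - ?e1}. f (?R ?e2) = ?R q"
  proof (cases "f (?R ?e2) \<in> {?R ?e1, ?R (- ?e1)}")
    case False
    \<comment> \<open>Then \<open>f e\<^sub>2 = \<plusminus> f e\<^sub>1\<close>, so \<open>e\<^sub>1\<close> and \<open>\<plusminus> e\<^sub>2\<close> coincide modulo \<open>M\<close>.\<close>
    have neg: "f (?R (- ?e1)) = ?R (- p)" using LAut_uminus[OF f fp] .
    have "f (?R ?e2) = f (?R ?e1) \<or> f (?R ?e2) = f (?R (- ?e1))"
      using False q'_cases p fp neg by auto
    then have "?R ?e2 = ?R ?e1 \<or> ?R ?e2 = ?R (- ?e1)" using LAut_inj[OF f] by blast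
    then have "{?R ?e2, ?R (- ?e2)} \<subseteq> {?R ?e1, ?R (- ?e1)}"
      using inv_residue_class[of M ?e2] inv_residue_class[of M ?e1]
        inv_residue_class[of M "- ?e1"] by auto
    then show ?thesis using q'_cases by auto
  qed auto
  then obtain q where q: "q \<in> {?e1, - ?e1}" and fq: "f (?R ?e2) = ?R q" by blast
  \<comment> \<open>The linear lift of \<open>f\<close> preserves the lattice because the lattice is
    the class of 0.\<close>
  have inv: "v $ 1 *s p + v $ 2 *s q \<in> col_lattice M" if v: "v \<in> col_lattice M" for v
  proof -
    have "v = v $ 1 *s ?e1 + v $ 2 *s ?e2"
      by (simp add: vec_eq_iff forall_2 axis_def)
    then have "f (?R v) = ?R (v $ 1 *s p + v $ 2 *s q)"
      using LAut_add[OF f LAut_scale[OF f fp] LAut_scale[OF f fq]] by metis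
    moreover have "?R v = ?R 0" using v by (simp add: residue_class_eq_iff)
    ultimately have "?R (v $ 1 *s p + v $ 2 *s q) = ?R 0" using LAut_zero[OF f] by simp
    then show ?thesis by (simp add: residue_class_eq_iff)
  qed
  have neg: "- u \<in> col_lattice M \<longleftrightarrow> u \<in> col_lattice M" for u
    using subgroup_int_vec_uminus[OF subgroup_col_lattice, of u M]
      subgroup_int_vec_uminus[OF subgroup_col_lattice, of "- u" M] by auto
  have forms: "v $ 1 *s ?e2 + v $ 2 *s ?e1 = vector [v $ 2, v $ 1]"
    "v $ 1 *s - ?e2 + v $ 2 *s - ?e1 = - vector [v $ 2, v $ 1]"
    "v $ 1 *s ?e2 + v $ 2 *s - ?e1 = vector [- v $ 2, v $ 1]"
    "v $ 1 *s - ?e2 + v $ 2 *s ?e1 = - vector [- v $ 2, v $ 1]" for v :: "int ^ 2"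
    by (simp_all add: vec_eq_iff forall_2 axis_def)
  from p q consider "p = ?e2" "q = ?e1" | "p = - ?e2" "q = - ?e1"
    | "p = ?e2" "q = - ?e1" | "p = - ?e2" "q = ?e1" by blast
  then show "?swap \<or> ?rot"
  proof cases
    case 1
    then have ?swap using inv forms(1) by metis
    then show ?thesis ..
  next
    case 2
    then have ?swap using inv forms(2) neg by metis
    then show ?thesis ..
  next
    case 3
    then have ?rot using inv forms(3) by metis
    then show ?thesis ..
  next
    case 4
    then have ?rot using inv forms(4) neg by metis
    then show ?thesis ..
  qed
next
  let ?R = "residue_class M" and ?e1 = "axis 1 1 :: int ^ 2" and ?e2 = "axis 2 1 :: int ^ 2"
  \<comment> \<open>\<open>?S\<close> is its own inverse and \<open>?T'\<close>, the negative of
    \<open>?T\<close>, is the inverse of \<open>?T\<close>; so invariance under the inverse follows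
    by negation.\<close>
  let ?S = "vector [vector [0, 1], vector [1, 0]] :: int ^ 2 ^ 2"
  let ?T = "vector [vector [0, - 1], vector [1, 0]] :: int ^ 2 ^ 2"
  let ?T' = "vector [vector [0, 1], vector [- 1, 0]] :: int ^ 2 ^ 2"
  have mv: "?S *v v = vector [v $ 2, v $ 1]" "?T *v v = vector [- v $ 2, v $ 1]"
    "?T' *v v = - vector [- v $ 2, v $ 1]" for v
    by (simp_all add: vec_eq_iff forall_2 matrix_vector_mult_def sum_2)
  have mm: "?S ** ?S = mat 1" "?T ** ?T' = mat 1" "?T' ** ?T = mat 1"
    by (simp_all add: vec_eq_iff forall_2 matrix_matrix_mult_def sum_2 mat_def)
  have neg2: "- vector [x, y] = (vector [- x, - y] :: int ^ 2)" for x y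
    by (simp add: vec_eq_iff forall_2)
  assume "?swap \<or> ?rot"
  then have "\<exists>f \<in> LAut M. f (?R ?e1) = ?R ?e2"
  proof
    assume swap: ?swap
    have "\<exists>f \<in> LAut M. \<forall>v. f (?R v) = ?R (?S *v v)"
      by (rule ex_LAut_of_invariant[OF mm(1) mm(1)]; unfold mv)
        (use swap in \<open>auto simp: signed_basis_2\<close>)
    moreover have "?S *v ?e1 = ?e2"
      unfolding mv by (simp add: vec_eq_iff forall_2 axis_def)
    ultimately show ?thesis by metis
  next
    assume rot: ?rot
    have rot': "vector [v $ 2, - v $ 1] \<in> col_lattice M" if "v \<in> col_lattice M" for v
      using subgroup_int_vec_uminus[OF subgroup_col_lattice] rot that neg2 by (metis minus_minus)
    have "\<exists>f \<in> LAut M. \<forall>v. f (?R v) = ?R (?T *v v)"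
      by (rule ex_LAut_of_invariant[OF mm(2) mm(3)]; unfold mv)
        (use rot rot' in \<open>auto simp: signed_basis_2 neg2\<close>)
    moreover have "?T *v ?e1 = ?e2"
      unfolding mv by (simp add: vec_eq_iff forall_2 axis_def)
    ultimately show ?thesis by metis
  qed
  \<comment> \<open>The index 1 is served by the identity.\<close>
  moreover have "\<exists>f \<in> LAut M. f (?R ?e1) = ?R ?e1"
  proof -
    have "\<exists>f \<in> LAut M. \<forall>v. f (?R v) = ?R (mat 1 *v v)"
      by (rule ex_LAut_of_invariant[of "mat 1" "mat 1"]) auto
    then show ?thesis by auto
  qed
  ultimately show "linearly_edge_transitive M"
    unfolding linearly_edge_transitive_def forall_2 by blast
qed

theorem theorem23:
  fixes M :: "int ^ 2 ^ 2"
  assumes "det M \<noteq> 0"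
  shows "linearly_edge_transitive M \<longleftrightarrow>
    (\<exists>a b :: int.
       right_equivalent M (vector [vector [a, b], vector [b, a]]) \<or>
       right_equivalent M (vector [vector [a, - b], vector [b, a]]) \<or>
       right_equivalent M (vector [vector [a, - b], vector [a, b]]))"
  unfolding right_equivalent_iff_col_lattice[OF assms] linearly_edge_transitive_2_iff
proof
  assume "(\<forall>v \<in> col_lattice M. vector [v $ 2, v $ 1] \<in> col_lattice M) \<or>
    (\<forall>v \<in> col_lattice M. vector [- v $ 2, v $ 1] \<in> col_lattice M)"
  then show "\<exists>a b. col_lattice M = col_lattice (vector [vector [a, b], vector [b, a]]) \<or>
      col_lattice M = col_lattice (vector [vector [a, - b], vector [b, a]]) \<or>
      col_lattice M = col_lattice (vector [vector [a, - b], vector [a, b]])"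
    using swap_invariant_lattice[OF subgroup_col_lattice[of M]]
      rotation_invariant_lattice[OF subgroup_col_lattice[of M]] by blast
next
  \<comment> \<open>It suffices to follow the generating columns: the reflection exchanges those of
    the first matrix, and fixes one and negates the other in the third; the quarter turn sends the
    first column of the second matrix to its second, and that to minus the first.\<close>
  have swap1: "(vector [v $ 2, v $ 1] :: int ^ 2)
      \<in> col_lattice (vector [vector [a, b], vector [b, a]])"
    if v: "v \<in> col_lattice (vector [vector [a, b], vector [b, a]])" for v :: "int ^ 2" and a b :: int
  proof -
    obtain m n where "v $ 1 = a * m + b * n" "v $ 2 = b * m + a * n"
      using v by (auto simp: mem_col_lattice_2)
    then show ?thesis
      unfolding mem_col_lattice_2 by (intro exI[of _ n] exI[of _ m]) simp
  qed
  have swap3: "(vector [v $ 2, v $ 1] :: int ^ 2)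
      \<in> col_lattice (vector [vector [a, - b], vector [a, b]])"
    if v: "v \<in> col_lattice (vector [vector [a, - b], vector [a, b]])" for v :: "int ^ 2" and a b :: int
  proof -
    obtain m n where "v $ 1 = a * m + - b * n" "v $ 2 = a * m + b * n"
      using v by (auto simp: mem_col_lattice_2)
    then show ?thesis
      unfolding mem_col_lattice_2 by (intro exI[of _ m] exI[of _ "- n"]) simp
  qed
  have rot: "(vector [- v $ 2, v $ 1] :: int ^ 2)
      \<in> col_lattice (vector [vector [a, - b], vector [b, a]])"
    if v: "v \<in> col_lattice (vector [vector [a, - b], vector [b, a]])" for v :: "int ^ 2" and a b :: int
  proof -
    obtain m n where "v $ 1 = a * m + - b * n" "v $ 2 = b * m + a * n"
      using v by (auto simp: mem_col_lattice_2)
    then show ?thesis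
      unfolding mem_col_lattice_2 by (intro exI[of _ "- n"] exI[of _ m]) simp
  qed
  assume "\<exists>a b. col_lattice M = col_lattice (vector [vector [a, b], vector [b, a]]) \<or>
      col_lattice M = col_lattice (vector [vector [a, - b], vector [b, a]]) \<or>
      col_lattice M = col_lattice (vector [vector [a, - b], vector [a, b]])"
  then show "(\<forall>v \<in> col_lattice M. vector [v $ 2, v $ 1] \<in> col_lattice M) \<or>
    (\<forall>v \<in> col_lattice M. vector [- v $ 2, v $ 1] \<in> col_lattice M)"
    using swap1 swap3 rot by metis
qed

end
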